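(* Let $1 \le p < \infty$ with $p \neq 2$, and let $T : \mathrm{Hol}(\mathbb{D}) \to \mathrm{Hol}(\mathbb{D})$ be a linear and continuous operator such that for all $f \in \mathrm{Hol}(\mathbb{D})$ and all integers $n \ge 1$, \[ \|T(f)\|_{p,n} = \|f\|_{p,n}, \] where \[ \|f\|_{p,n} = \left( \frac{1}{2\pi} \int_0^{2\pi} \left| f\left( \left(1 - \tfrac{1}{n}\right) e^{i\theta} \right) \right|^p \, d\theta \right)^{1/p}. \] Then there exist $\alpha, \beta \in \mathbb{T}$ such that for all $f \in \mathrm{Hol}(\mathbb{D})$ and all $z \in \mathbb{D}$, \[ T(f)(z) = \alpha f(\beta z). \]
   Context: $\mathbb{D} = \{z \in \mathbb{C} : |z| < 1\}$ is the open unit disc and $\mathbb{T} = \{z \in \mathbb{C} : |z| = 1\}$ is the unit circle. $\mathrm{Hol}(\mathbb{D})$ is the space of all holomorphic functions on $\mathbb{D}$, a Fréchet space with the topology of uniform convergence on compact subsets of $\mathbb{D}$. *)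

theory Defs
  imports "HOL-Complex_Analysis.Complex_Analysis"
begin

abbreviation disc :: "complex set" (\<open>\<bbbD>\<close>)
  where "\<bbbD> \<equiv> ball 0 1"

abbreviation circle :: "complex set" (\<open>\<bbbT>\<close>)
  where "\<bbbT> \<equiv> sphere 0 1"

(* A function on the disc is represented by its extension by zero to the whole plane.
   This makes equality in Hol(D) the equality of HOL functions, and the vector space
   operations are the pointwise ones. *)
definition Hol :: "(complex \<Rightarrow> complex) set"
  where "Hol = {f. f holomorphic_on \<bbbD> \<and> (\<forall>z. z \<notin> \<bbbD> \<longrightarrow> f z = 0)}"

definition hol_nbhd :: "(complex \<Rightarrow> complex) \<Rightarrow> complex set \<Rightarrow> real \<Rightarrow> (complex \<Rightarrow> complex) set"
  where "hol_nbhd f K e = {g \<in> Hol. \<forall>z\<in>K. dist (f z) (g z) < e}"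

(* Uniform convergence on compact subsets of the disc: the sets hol_nbhd f K e, for K a
   compact subset of the disc and e > 0, form a neighbourhood basis at f. *)
definition Hol_topology :: "(complex \<Rightarrow> complex) topology"
  where "Hol_topology = topology (\<lambda>U. U \<subseteq> Hol \<and>
    (\<forall>f\<in>U. \<exists>K e. compact K \<and> K \<subseteq> \<bbbD> \<and> 0 < e \<and> hol_nbhd f K e \<subseteq> U))"

lemma istopology_Hol:
  "istopology (\<lambda>U. U \<subseteq> Hol \<and>
    (\<forall>f\<in>U. \<exists>K e. compact K \<and> K \<subseteq> \<bbbD> \<and> 0 < e \<and> hol_nbhd f K e \<subseteq> U))"
  (is "istopology ?P")
  unfolding istopology_def
proof (rule conjI; intro allI impI)
  fix S T assume S: "?P S" and T: "?P T"
  show "?P (S \<inter> T)"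
  proof (intro conjI ballI)
    show "S \<inter> T \<subseteq> Hol" using S by blast
  next
    fix f assume f: "f \<in> S \<inter> T"
    obtain K d where K: "compact K" "K \<subseteq> \<bbbD>" "0 < d" "hol_nbhd f K d \<subseteq> S"
      using S f by blast
    obtain L e where L: "compact L" "L \<subseteq> \<bbbD>" "0 < e" "hol_nbhd f L e \<subseteq> T"
      using T f by blast
    have *: "hol_nbhd f (K \<union> L) (min d e) \<subseteq> hol_nbhd f K d \<inter> hol_nbhd f L e"
      by (auto simp: hol_nbhd_def)
    show "\<exists>K e. compact K \<and> K \<subseteq> \<bbbD> \<and> 0 < e \<and> hol_nbhd f K e \<subseteq> S \<inter> T"
    proof (intro exI conjI)
      show "compact (K \<union> L)" using K(1) L(1) by (rule compact_Un)
      show "K \<union> L \<subseteq> \<bbbD>" using K(2) L(2) by (rule Un_least)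
      show "0 < min d e" using K(3) L(3) by simp
      show "hol_nbhd f (K \<union> L) (min d e) \<subseteq> S \<inter> T" using * K(4) L(4) by blast
    qed
  qed
next
  fix \<K> assume \<K>: "\<forall>S\<in>\<K>. ?P S"
  show "?P (\<Union>\<K>)"
  proof (intro conjI ballI)
    show "\<Union>\<K> \<subseteq> Hol" using \<K> by (simp add: Union_least)
  next
    fix f assume "f \<in> \<Union>\<K>"
    then obtain S where S: "S \<in> \<K>" "f \<in> S" by blast
    have "?P S" using \<K> S(1) by (rule bspec)
    then have "\<exists>K e. compact K \<and> K \<subseteq> \<bbbD> \<and> 0 < e \<and> hol_nbhd f K e \<subseteq> S"
      using S(2) by (rule bspec[OF conjunct2])
    then obtain K e where K: "compact K" "K \<subseteq> \<bbbD>" "0 < e" "hol_nbhd f K e \<subseteq> S"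
      by auto
    show "\<exists>K e. compact K \<and> K \<subseteq> \<bbbD> \<and> 0 < e \<and> hol_nbhd f K e \<subseteq> \<Union>\<K>"
    proof (intro exI conjI)
      show "hol_nbhd f K e \<subseteq> \<Union>\<K>" using K(4) S(1) by (rule order_trans[OF _ Union_upper])
    qed (fact K)+
  qed
qed

lemma openin_Hol_topology:
  "openin Hol_topology U \<longleftrightarrow> U \<subseteq> Hol \<and>
    (\<forall>f\<in>U. \<exists>K e. compact K \<and> K \<subseteq> \<bbbD> \<and> 0 < e \<and> hol_nbhd f K e \<subseteq> U)"
  unfolding Hol_topology_def topology_inverse'[OF istopology_Hol] ..

lemma topspace_Hol_topology: "topspace Hol_topology = Hol"
proof (rule subset_antisym)
  show "topspace Hol_topology \<subseteq> Hol"
    using openin_topspace[of Hol_topology] unfolding openin_Hol_topology by (rule conjunct1)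
  have "\<exists>K e. compact K \<and> K \<subseteq> \<bbbD> \<and> 0 < e \<and> hol_nbhd f K e \<subseteq> Hol" for f
    by (rule exI[of _ "{}"], rule exI[of _ 1]) (simp add: hol_nbhd_def)
  then have "openin Hol_topology Hol"
    unfolding openin_Hol_topology by simp
  then show "Hol \<subseteq> topspace Hol_topology"
    by (rule openin_subset)
qed

definition linear_on_Hol :: "((complex \<Rightarrow> complex) \<Rightarrow> complex \<Rightarrow> complex) \<Rightarrow> bool"
  where "linear_on_Hol T \<longleftrightarrow>
    (\<forall>f\<in>Hol. \<forall>g\<in>Hol. T (\<lambda>z. f z + g z) = (\<lambda>z. T f z + T g z)) \<and>
    (\<forall>c. \<forall>f\<in>Hol. T (\<lambda>z. c * f z) = (\<lambda>z. c * T f z))"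

definition pn_norm :: "real \<Rightarrow> nat \<Rightarrow> (complex \<Rightarrow> complex) \<Rightarrow> real"
  where "pn_norm p n f =
    (1 / (2 * pi) * integral {0..2 * pi}
       (\<lambda>\<theta>. norm (f (of_real (1 - 1 / real n) * exp (\<i> * of_real \<theta>))) powr p)) powr (1 / p)"

end

theory Submission
  imports Defs
begin

text \<open>
  Evaluating at the circle of radius 0 gives \<open>|T 1 0| = 1\<close>, and equality in the mean value
  inequality on another circle makes \<open>T 1\<close> a constant \<open>\<alpha>\<close>. Let \<open>S = T / \<alpha>\<close>, so \<open>S 1 = 1\<close>. Averaging
  \<open>|1 + c f|\<^sup>p\<close> over \<open>c = t \<zeta>\<close>, with \<open>\<zeta>\<close> the fifth roots of unity, and expanding as \<open>t \<rightarrow> 0\<close> shows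
  that \<open>S\<close> preserves the means of \<open>|f|\<^sup>2\<close> and, since \<open>p \<noteq> 2\<close>, of \<open>|f|\<^sup>4\<close> on each circle. By polarisation
  \<open>S\<close> preserves the mean of \<open>|f\<^sup>2 - g|\<^sup>2\<close>, in the sense that it equals that of \<open>|(S f)\<^sup>2 - S g|\<^sup>2\<close>;
  taking \<open>g = f\<^sup>2\<close>, \<open>S\<close> is multiplicative. Hence \<open>S f = f \<circ> G\<close> for \<open>G = S z\<close>. The second and fourth
  moments of \<open>G\<close> on the circle of radius \<open>r\<close> are \<open>r\<^sup>2\<close> and \<open>r\<^sup>4\<close>, so \<open>|G| = r\<close> there, and the Schwarz
  lemma makes \<open>G\<close> a rotation.
\<close>

section \<open>Integrals over circles\<close>

text \<open>The factor \<open>1 / (2 * pi)\<close> is left out, and at \<open>r = 0\<close> the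
  circle is the origin. The value type covers complex integrands for the mean value property and
  real ones for moments.\<close>

definition circle_int :: "real \<Rightarrow> (complex \<Rightarrow> 'a::real_normed_vector) \<Rightarrow> 'a"
  where "circle_int r F = integral {0..2 * pi} (\<lambda>\<theta>. F (of_real r * exp (\<i> * of_real \<theta>)))"

lemma sphere_param: "0 \<le> r \<Longrightarrow> of_real r * exp (\<i> * of_real \<theta>) \<in> sphere 0 r"
  by (simp add: norm_mult)

lemma sphere_paramE:
  assumes "z \<in> sphere 0 r"
  obtains \<theta> where "\<theta> \<in> {0..2*pi}" "z = of_real r * exp (\<i> * of_real \<theta>)"
proof -
  have "z = of_real r * exp (\<i> * of_real (Arg2pi z))"
    using Arg2pi_eq[of z] assms by simp
  moreover have "Arg2pi z \<in> {0..2*pi}"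
    using Arg2pi_ge_0[of z] Arg2pi_lt_2pi[of z] by simp
  ultimately show ?thesis using that by blast
qed

lemma continuous_on_circle_param:
  fixes F :: "complex \<Rightarrow> 'a::real_normed_vector"
  assumes "0 \<le> r" "continuous_on (sphere 0 r) F"
  shows "continuous_on {0..2*pi} (\<lambda>\<theta>. F (of_real r * exp (\<i> * of_real \<theta>)))"
  by (rule continuous_on_compose2[OF assms(2)])
     (auto intro!: continuous_intros simp: norm_mult assms(1))

lemma integrable_circle:
  fixes F :: "complex \<Rightarrow> 'a::banach"
  assumes "0 \<le> r" "continuous_on (sphere 0 r) F"
  shows "(\<lambda>\<theta>. F (of_real r * exp (\<i> * of_real \<theta>))) integrable_on {0..2*pi}"
  using continuous_on_circle_param[OF assms] by (rule integrable_continuous_real)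

lemma circle_int_cong:
  assumes "0 \<le> r" "\<And>z. z \<in> sphere 0 r \<Longrightarrow> F z = G z"
  shows "circle_int r F = circle_int r G"
  unfolding circle_int_def using assms by (intro integral_cong) (simp add: norm_mult)

lemma circle_int_add:
  fixes F G :: "complex \<Rightarrow> 'a::banach"
  assumes "0 \<le> r" "continuous_on (sphere 0 r) F" "continuous_on (sphere 0 r) G"
  shows "circle_int r (\<lambda>z. F z + G z) = circle_int r F + circle_int r G"
  unfolding circle_int_def by (intro integral_add integrable_circle assms)

lemma circle_int_diff:
  fixes F G :: "complex \<Rightarrow> 'a::banach"
  assumes "0 \<le> r" "continuous_on (sphere 0 r) F" "continuous_on (sphere 0 r) G"
  shows "circle_int r (\<lambda>z. F z - G z) = circle_int r F - circle_int r G"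
  unfolding circle_int_def by (intro integral_diff integrable_circle assms)

lemma circle_int_cmult:
  fixes F :: "complex \<Rightarrow> real"
  shows "circle_int r (\<lambda>z. c * F z) = c * circle_int r F"
  unfolding circle_int_def by simp

lemma circle_int_const [simp]: "circle_int r (\<lambda>z. c::real) = 2 * pi * c"
  unfolding circle_int_def by simp

lemma circle_int_sum:
  fixes F :: "'b \<Rightarrow> complex \<Rightarrow> 'a::banach"
  assumes "0 \<le> r" "finite A" "\<And>a. a \<in> A \<Longrightarrow> continuous_on (sphere 0 r) (F a)"
  shows "circle_int r (\<lambda>z. \<Sum>a\<in>A. F a z) = (\<Sum>a\<in>A. circle_int r (F a))"
  unfolding circle_int_def by (intro integral_sum integrable_circle assms)

lemma circle_int_mono:
  fixes F G :: "complex \<Rightarrow> real"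
  assumes "0 \<le> r" "continuous_on (sphere 0 r) F" "continuous_on (sphere 0 r) G"
    and "\<And>z. z \<in> sphere 0 r \<Longrightarrow> F z \<le> G z"
  shows "circle_int r F \<le> circle_int r G"
  unfolding circle_int_def
  by (intro integral_le integrable_circle assms sphere_param)

text \<open>This turns equality of means into a pointwise identity: a continuous nonnegative
  integrand with zero integral vanishes on the closed parameter interval, which covers the
  circle.\<close>

lemma circle_int_eq_0D:
  fixes F :: "complex \<Rightarrow> real"
  assumes "0 \<le> r" "continuous_on (sphere 0 r) F"
    and "\<And>z. z \<in> sphere 0 r \<Longrightarrow> 0 \<le> F z" and "circle_int r F \<le> 0" and "z \<in> sphere 0 r"
  shows "F z = 0"
proof -
  have "0 \<le> circle_int r F"
    using circle_int_mono[of r "\<lambda>_. 0" F] assms by simp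
  then have "circle_int r F = 0" using assms(4) by simp
  then have *: "\<forall>\<theta>\<in>{0..2*pi}. F (of_real r * exp (\<i> * of_real \<theta>)) = 0"
    unfolding circle_int_def using assms(1,3)
    by (subst (asm) integral_eq_0_iff)
       (auto intro!: continuous_on_circle_param assms(1,2) simp: norm_mult)
  obtain \<theta> where "\<theta> \<in> {0..2*pi}" "z = of_real r * exp (\<i> * of_real \<theta>)"
    using sphere_paramE[OF assms(5)] .
  then show ?thesis using * by simp
qed

text \<open>Cauchy's formula at the centre: the factor \<open>1 / u\<close> cancels against
  \<open>du = \<i> u d\<theta>\<close>.\<close>

lemma circle_int_mean_value:
  fixes f :: "complex \<Rightarrow> complex"
  assumes "f holomorphic_on cball 0 r" "0 < r"
  shows "circle_int r f = 2 * pi * f 0"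
proof -
  have "((\<lambda>u. f u / (u - 0)) has_contour_integral (2 * of_real pi * \<i> * f 0)) (circlepath 0 r)"
    using assms by (intro Cauchy_integral_circlepath_simple) auto
  then have "((\<lambda>t. f (r * cis t) / (r * cis t) * r * \<i> * cis t) has_integral 2 * of_real pi * \<i> * f 0) {0..2*pi}"
    unfolding circlepath_def by (simp add: has_contour_integral_part_circlepath_iff)
  then have "((\<lambda>t. \<i> * f (r * cis t)) has_integral 2 * of_real pi * \<i> * f 0) {0..2*pi}"
    using assms(2) by (simp add: mult.commute)
  then have "((\<lambda>t. -\<i> * (\<i> * f (r * cis t))) has_integral -\<i> * (2 * of_real pi * \<i> * f 0)) {0..2*pi}"
    by (rule has_integral_mult_right)
  then have "((\<lambda>t. f (r * cis t)) has_integral (2 * of_real pi * f 0)) {0..2*pi}"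
    by (simp add: algebra_simps)
  then show ?thesis
    unfolding circle_int_def by (simp add: cis_conv_exp integral_unique)
qed

lemma circle_int_Re:
  assumes "0 \<le> r" "continuous_on (sphere 0 r) f"
  shows "circle_int r (\<lambda>z. Re (f z)) = Re (circle_int r f)"
proof -
  have "((\<lambda>\<theta>. f (of_real r * exp (\<i> * of_real \<theta>))) has_integral circle_int r f) {0..2*pi}"
    unfolding circle_int_def by (intro integrable_integral integrable_circle assms)
  from has_integral_Re[OF this] show ?thesis
    unfolding circle_int_def by (simp add: integral_unique)
qed

text \<open>The maximum modulus principle gives zero inside the circle, and analytic continuation
  carries this to the whole disc.\<close>

lemma holomorphic_eq_0_of_circle:
  assumes f: "f holomorphic_on ball 0 1" and r: "0 < r" "r < 1"
    and 0: "\<And>z. z \<in> sphere 0 r \<Longrightarrow> f z = 0" and z: "z \<in> ball 0 1"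
  shows "f z = 0"
proof (rule analytic_continuation_open[of "ball 0 r" "ball 0 1" f "\<lambda>_. 0"])
  fix w :: complex assume w: "w \<in> ball 0 r"
  have "norm (f w) \<le> 0"
  proof (rule maximum_modulus_frontier[of f "cball 0 r"])
    show "f holomorphic_on interior (cball 0 r)"
      using f r by (auto intro: holomorphic_on_subset)
    show "continuous_on (closure (cball 0 r)) f"
      using f r by (auto intro!: holomorphic_on_imp_continuous_on intro: holomorphic_on_subset)
  qed (use w 0 r in auto)
  then show "f w = 0" by simp
qed (use f r z in auto)

text \<open>The tangent at 1 to a convex function. For positive \<open>x\<close>, multiply
  \<open>x powr (p - 1) \<ge> 1 + (p - 1) * ln x\<close> by \<open>x\<close> and use
  \<open>ln x \<ge> 1 - 1 / x\<close>.\<close>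

lemma powr_Bernoulli:
  fixes p x :: real
  assumes "1 \<le> p" "0 \<le> x"
  shows "1 + p * (x - 1) \<le> x powr p"
proof (cases "x = 0")
  case False
  then have x: "0 < x" using assms by simp
  have "1 - 1 / x \<le> ln x"
    using ln_le_minus_one[of "1/x"] x by (simp add: ln_div)
  then have "1 + (p - 1) * (1 - 1 / x) \<le> 1 + (p - 1) * ln x"
    using assms by (simp add: mult_left_mono)
  also have "\<dots> \<le> x powr (p - 1)"
    using x exp_ge_add_one_self[of "(p - 1) * ln x"] by (simp add: powr_def)
  finally have "x * (1 + (p - 1) * (1 - 1 / x)) \<le> x * x powr (p - 1)"
    using x by (simp add: mult_left_mono)
  also have "x * x powr (p - 1) = x powr p"
    using x by (simp add: powr_diff)
  also have "x * (1 + (p - 1) * (1 - 1 / x)) = 1 + p * (x - 1)"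
    using x by (simp add: field_simps)
  finally show ?thesis .
qed (use assms in simp)

section \<open>Averages of a power over fifth roots of unity\<close>

text \<open>Five roots of unity, because averaging over four would keep the holomorphic term in
  \<open>w ^ 4\<close>, which has the same order as the fourth moment.\<close>

definition binomial_mean :: "real \<Rightarrow> complex \<Rightarrow> real"
  where "binomial_mean p w = (\<Sum>j<5. norm (1 + exp (2 * of_real pi * \<i> * of_nat j / 5) * w) powr p) / 5"

text \<open>Since \<open>\<zeta> j ^ k = \<zeta> k ^ j\<close>, this is a geometric sum whose ratio
  \<open>x = \<zeta> k / \<zeta> l\<close> is an \<open>N\<close>-th root of unity, equal to 1 only
  for \<open>k = l\<close>.\<close>

lemma roots_of_unity_sum:
  fixes k l N :: nat
  assumes "k < N" "l < N"
  defines "\<zeta> \<equiv> \<lambda>j::nat. exp (2 * of_real pi * \<i> * of_nat j / of_nat N)"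
  shows "(\<Sum>j<N. \<zeta> j ^ k * cnj (\<zeta> j) ^ l) = (if k = l then of_nat N else 0)"
proof -
  define x where "x = \<zeta> k / \<zeta> l"
  have N: "1 \<le> N" using assms by simp
  have nz: "\<zeta> j \<noteq> 0" for j by (simp add: \<zeta>_def)
  have cnj: "cnj (\<zeta> j) = 1 / \<zeta> j" for j
  proof -
    have "cnj (\<zeta> j) = exp (- (2 * of_real pi * \<i> * of_nat j / of_nat N))"
      unfolding \<zeta>_def exp_cnj by (simp add: exp_cnj)
    then show ?thesis by (simp add: \<zeta>_def exp_minus inverse_eq_divide)
  qed
  have pow: "\<zeta> j ^ k = \<zeta> k ^ j" for j k
    by (simp add: \<zeta>_def flip: exp_of_nat_mult) (simp add: mult_ac)
  have x_pow: "\<zeta> j ^ k * cnj (\<zeta> j) ^ l = x ^ j" for j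
    by (simp add: cnj pow[of j] x_def power_divide)
  have "\<zeta> N = exp (2 * of_real pi * \<i>)"
    using N by (simp add: \<zeta>_def)
  then have one: "\<zeta> N = 1"
    by (simp only: exp_two_pi_i)
  then have "x ^ N = 1"
    by (simp add: x_def power_divide one flip: pow[of N])
  show ?thesis
  proof (cases "k = l")
    case True
    then have "x = 1" by (simp add: x_def nz)
    then show ?thesis unfolding x_pow using True by simp
  next
    case False
    then have "\<zeta> k \<noteq> \<zeta> l"
      using assms(1,2) by (simp add: \<zeta>_def complex_root_unity_eq[OF N])
    then have "x \<noteq> 1" by (simp add: x_def nz)
    then show ?thesis
      using False \<open>x ^ N = 1\<close> by (simp add: x_pow geometric_sum)
  qed
qed

text \<open>Expand the squared norm as a double sum over \<open>k\<close> and \<open>l\<close>;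
  summing over the roots removes the terms with \<open>k \<noteq> l\<close>.\<close>

lemma roots_of_unity_Parseval:
  fixes a :: "nat \<Rightarrow> complex" and w :: complex and N :: nat
  defines "\<zeta> \<equiv> \<lambda>j::nat. exp (2 * of_real pi * \<i> * of_nat j / of_nat N)"
  shows "(\<Sum>j<N. norm (\<Sum>k<N. a k * (\<zeta> j * w) ^ k) ^ 2) = N * (\<Sum>k<N. norm (a k * w ^ k) ^ 2)"
proof -
  have "complex_of_real (\<Sum>j<N. norm (\<Sum>k<N. a k * (\<zeta> j * w) ^ k) ^ 2)
      = (\<Sum>j<N. \<Sum>k<N. \<Sum>l<N. (a k * w ^ k) * cnj (a l * w ^ l) * (\<zeta> j ^ k * cnj (\<zeta> j) ^ l))"
    by (simp add: complex_norm_square sum_product power_mult_distrib mult_ac del: of_real_power)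
  also have "\<dots> = (\<Sum>k<N. \<Sum>l<N. \<Sum>j<N. (a k * w ^ k) * cnj (a l * w ^ l) * (\<zeta> j ^ k * cnj (\<zeta> j) ^ l))"
    by (subst sum.swap, intro sum.cong refl sum.swap)
  also have "\<dots> = (\<Sum>k<N. \<Sum>l<N. (a k * w ^ k) * cnj (a l * w ^ l) * (if k = l then of_nat N else 0))"
    unfolding sum_distrib_left[symmetric] \<zeta>_def
    by (intro sum.cong refl arg_cong2[where f="(*)"] roots_of_unity_sum) auto
  also have "\<dots> = complex_of_real (N * (\<Sum>k<N. norm (a k * w ^ k) ^ 2))"
    by (simp add: complex_norm_square sum_distrib_left mult_ac if_distrib[of "(*) _"] sum.delta' cong: if_cong del: of_real_power)
  finally show ?thesis by (simp only: of_real_eq_iff)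
qed

text \<open>The tail has the factor \<open>w ^ N\<close>, and what remains is dominated by an
  absolutely convergent series at radius \<open>r\<close>.\<close>

lemma power_series_remainder:
  fixes c :: "nat \<Rightarrow> complex"
  assumes sums: "\<And>w. norm w < R \<Longrightarrow> (\<lambda>n. c n * w ^ n) sums f w" and r: "0 < r" "r < R"
  shows "\<exists>C\<ge>0. \<forall>w. norm w \<le> r \<longrightarrow> norm (f w - (\<Sum>n<N. c n * w ^ n)) \<le> C * norm w ^ N"
proof -
  \<comment> \<open>Convergence at a point strictly between \<open>r\<close> and \<open>R\<close>
    makes the series absolutely convergent at \<open>r\<close>.\<close>
  have "summable (\<lambda>n. c n * of_real ((r + R) / 2) ^ n)"
    by (rule sums_summable[OF sums]) (unfold norm_of_real, use r in simp)
  then have "summable (\<lambda>n. norm (c n * of_real r ^ n))"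
    by (rule powser_insidea) (unfold norm_of_real, use r in simp)
  then have "summable (\<lambda>n. norm (c (n + N) * of_real r ^ (n + N)))"
    by (rule summable_ignore_initial_segment)
  then have "summable (\<lambda>n. norm (c (n + N) * of_real r ^ (n + N)) / r ^ N)"
    by (rule summable_divide)
  then have S: "summable (\<lambda>n. norm (c (n + N)) * r ^ n)"
    using r by (simp add: norm_mult norm_power power_add)
  show ?thesis
  proof (intro exI[of _ "\<Sum>n. norm (c (n + N)) * r ^ n"] conjI allI impI)
    show "0 \<le> (\<Sum>n. norm (c (n + N)) * r ^ n)"
      using r by (intro suminf_nonneg S) simp
    fix w :: complex assume w: "norm w \<le> r"
    have "(\<lambda>n. c (n + N) * w ^ (n + N)) sums (f w - (\<Sum>n<N. c n * w ^ n))"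
      using sums[of w] w r by (intro sums_split_initial_segment) simp
    then have "f w - (\<Sum>n<N. c n * w ^ n) = (\<Sum>n. c (n + N) * w ^ (n + N))"
      by (rule sums_unique)
    also have "norm \<dots> \<le> (\<Sum>n. norm (c (n + N)) * r ^ n * norm w ^ N)"
    proof (rule norm_suminf_le)
      show "summable (\<lambda>n. norm (c (n + N)) * r ^ n * norm w ^ N)"
        by (rule summable_mult2[OF S])
      show "norm (c (n + N) * w ^ (n + N)) \<le> norm (c (n + N)) * r ^ n * norm w ^ N" for n
        unfolding norm_mult norm_power power_add mult.assoc[symmetric]
        by (intro mult_right_mono mult_left_mono power_mono w) auto
    qed
    also have "\<dots> = (\<Sum>n. norm (c (n + N)) * r ^ n) * norm w ^ N"
      by (rule suminf_mult2[OF S, symmetric])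
    finally show "norm (f w - (\<Sum>n<N. c n * w ^ n)) \<le> (\<Sum>n. norm (c (n + N)) * r ^ n) * norm w ^ N" .
  qed
qed

lemma abs_diff_squares_le:
  fixes x y :: complex
  assumes "norm (x - y) \<le> e" "norm x \<le> M" "norm y \<le> M"
  shows "\<bar>norm x ^ 2 - norm y ^ 2\<bar> \<le> 2 * M * e"
proof -
  have "\<bar>norm x ^ 2 - norm y ^ 2\<bar> = (norm x + norm y) * \<bar>norm x - norm y\<bar>"
    by (simp add: power2_eq_square square_diff_square_factored abs_mult)
  also have "\<dots> \<le> (2 * M) * e"
    using assms norm_triangle_ineq3[of x y] norm_ge_zero[of x] by (intro mult_mono) linarith+
  finally show ?thesis .
qed

text \<open>
  Writing \<open>|1 + w|\<^sup>p = |(1 + w)\<^sup>p\<^sup>/\<^sup>2|\<^sup>2\<close> with the binomial series \<open>\<Sum> c\<^sub>n w\<^sup>n\<close> of the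
  inner power, the average keeps the diagonal terms \<open>|c\<^sub>n|\<^sup>2 |w|\<^sup>2\<^sup>n\<close> up to an error of order 5.
  The coefficient \<open>b = |c\<^sub>2|\<^sup>2\<close> is nonzero precisely because \<open>p \<noteq> 2\<close> (and \<open>p \<noteq> 0\<close>).
\<close>

lemma binomial_mean_expansion:
  assumes "0 < p" "p \<noteq> 2"
  obtains a b C where "a > 0" "b > 0" "C \<ge> 0"
    "\<And>w. norm w \<le> 1/2 \<Longrightarrow>
       \<bar>binomial_mean p w - (1 + a * norm w ^ 2 + b * norm w ^ 4)\<bar> \<le> C * norm w ^ 5"
proof -
  define q where "q = complex_of_real (p / 2)"
  define c where "c n = q gchoose n" for n
  define A where "A w = (\<Sum>n<5. c n * w ^ n)" for w
  define B where "B w = (1 + w) powr q" for w :: complex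
  define \<zeta> where "\<zeta> j = exp (2 * of_real pi * \<i> * of_nat j / of_nat 5)" for j :: nat
  define a where "a = norm (c 1) ^ 2"
  define b where "b = norm (c 2) ^ 2"
  have c: "c 0 = 1" "c (Suc 0) = q" "c 2 = q * (q - 1) / 2"
    by (simp_all add: c_def gbinomial_1 gbinomial_prod_rev numeral_2_eq_2)
  have "q \<noteq> 0" "q \<noteq> 1" using assms by (auto simp: q_def complex_eq_iff)
  then have ab: "a > 0" "b > 0" by (simp_all add: a_def b_def c)
  have "\<exists>C\<ge>0. \<forall>w. norm w \<le> 1/2 \<longrightarrow> norm (B w - A w) \<le> C * norm w ^ 5"
    unfolding A_def
    by (rule power_series_remainder[where R = 1]) (auto simp: B_def c_def gen_binomial_complex)
  then obtain C where C: "C \<ge> 0" "\<And>w. norm w \<le> 1/2 \<Longrightarrow> norm (B w - A w) \<le> C * norm w ^ 5"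
    by blast
  \<comment> \<open>A common bound for \<open>A w\<close> and \<open>B w\<close> on
    \<open>norm w \<le> 1/2\<close>, where the remainder is at most \<open>C\<close>.\<close>
  define M where "M = (\<Sum>n<5. norm (c n)) + C"
  have A_le: "norm (A w) \<le> (\<Sum>n<5. norm (c n))" if "norm w \<le> 1/2" for w
    unfolding A_def
  proof (rule sum_norm_le)
    fix n
    have "norm w ^ n \<le> 1" using that by (intro power_le_one) auto
    then show "norm (c n * w ^ n) \<le> norm (c n)"
      by (simp add: norm_mult norm_power mult_left_le)
  qed
  have sq: "\<bar>norm (1 + w) powr p - norm (A w) ^ 2\<bar> \<le> 2 * M * (C * norm w ^ 5)" if w: "norm w \<le> 1/2" for w
  proof -
    have "norm (B w) ^ 2 = norm (1 + w) powr p"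
      by (simp add: B_def q_def norm_powr_real_powr' power2_eq_square flip: powr_add)
    moreover have "norm w ^ 5 \<le> 1" using w by (intro power_le_one) auto
    then have "C * norm w ^ 5 \<le> C" using C(1) by (simp add: mult_left_le)
    then have "norm (B w) \<le> M"
      using C(2)[OF w] A_le[OF w] norm_triangle_ineq2[of "B w" "A w"] unfolding M_def by linarith
    moreover have "norm (A w) \<le> M" using A_le[OF w] C(1) by (simp add: M_def)
    ultimately show ?thesis
      using abs_diff_squares_le[OF C(2)[OF w]] by metis
  qed
  \<comment> \<open>The truncation error, then the diagonal terms of degree 6 and 8, which are at
    most their coefficients times \<open>norm w ^ 5\<close>.\<close>
  define K where "K = 2 * M * C + norm (c 3) ^ 2 + norm (c 4) ^ 2"
  have "M \<ge> 0" unfolding M_def using C(1) by (simp add: sum_nonneg)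
  then have "K \<ge> 0" using C(1) by (simp add: K_def)
  moreover have "\<bar>binomial_mean p w - (1 + a * norm w ^ 2 + b * norm w ^ 4)\<bar> \<le> K * norm w ^ 5"
    if w: "norm w \<le> 1/2" for w
  proof -
    have n: "norm (\<zeta> j * w) = norm w" for j
      by (simp add: \<zeta>_def norm_mult)
    have mean: "(\<Sum>j<5. norm (A (\<zeta> j * w)) ^ 2) = 5 * (\<Sum>n<5. norm (c n * w ^ n) ^ 2)"
      using roots_of_unity_Parseval[where a = c and w = w and N = 5] by (simp add: A_def \<zeta>_def)
    have "\<bar>(\<Sum>j<5. norm (1 + \<zeta> j * w) powr p) - (\<Sum>j<5. norm (A (\<zeta> j * w)) ^ 2)\<bar>
        \<le> (\<Sum>j<5::nat. 2 * M * (C * norm w ^ 5))"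
      unfolding sum_subtractf[symmetric]
      using sq[of "\<zeta> j * w" for j] w by (intro order_trans[OF sum_abs] sum_mono) (simp add: n)
    then have 1: "\<bar>binomial_mean p w - (\<Sum>n<5. norm (c n * w ^ n) ^ 2)\<bar> \<le> 2 * M * C * norm w ^ 5"
      unfolding mean by (simp add: binomial_mean_def \<zeta>_def field_simps)
    have "(\<Sum>n<5. norm (c n * w ^ n) ^ 2) = 1 + a * norm w ^ 2 + b * norm w ^ 4 +
        (norm (c 3) ^ 2 * norm w ^ 6 + norm (c 4) ^ 2 * norm w ^ 8)"
      by (simp add: eval_nat_numeral a_def b_def c(1) norm_mult norm_power power_mult_distrib)
    moreover have "norm w ^ 6 \<le> norm w ^ 5" "norm w ^ 8 \<le> norm w ^ 5"
      using w by (auto intro!: power_decreasing)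
    then have "norm (c 3) ^ 2 * norm w ^ 6 + norm (c 4) ^ 2 * norm w ^ 8
        \<le> norm (c 3) ^ 2 * norm w ^ 5 + norm (c 4) ^ 2 * norm w ^ 5"
      by (intro add_mono mult_left_mono) auto
    moreover have "0 \<le> norm (c 3) ^ 2 * norm w ^ 6 + norm (c 4) ^ 2 * norm w ^ 8" by simp
    ultimately show ?thesis
      using 1 unfolding K_def ring_distribs by linarith
  qed
  ultimately show ?thesis using that ab by blast
qed

section \<open>Second and fourth moments on a circle\<close>

lemma continuous_on_norm_powr:
  fixes f :: "'b::topological_space \<Rightarrow> 'a::real_normed_vector" and p :: real
  assumes "continuous_on S f" "0 < p"
  shows "continuous_on S (\<lambda>x. norm (f x) powr p)"
  using assms by (intro continuous_on_powr' continuous_intros) auto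

text \<open>Each summand on the right integrates \<open>norm (1 + c * f z) powr p\<close> for a
  constant \<open>c\<close>, so identities for such integrals pass to the average.\<close>

lemma circle_int_binomial_mean:
  assumes "0 < p" "0 \<le> r" "continuous_on (sphere 0 r) f"
  shows "circle_int r (\<lambda>z. binomial_mean p (t * f z)) =
    (\<Sum>j<5::nat. circle_int r (\<lambda>z. norm (1 + exp (2 * of_real pi * \<i> * of_nat j / 5) * t * f z) powr p)) / 5"
proof -
  have "circle_int r (\<lambda>z. binomial_mean p (t * f z)) = circle_int r (\<lambda>z. (1/5) *
     (\<Sum>j<5::nat. norm (1 + exp (2 * of_real pi * \<i> * of_nat j / 5) * t * f z) powr p))"
    by (simp add: binomial_mean_def mult.assoc)
  also have "\<dots> = (1/5) * circle_int r (\<lambda>z.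
     (\<Sum>j<5::nat. norm (1 + exp (2 * of_real pi * \<i> * of_nat j / 5) * t * f z) powr p))"
    by (rule circle_int_cmult)
  also have "circle_int r (\<lambda>z.
     (\<Sum>j<5::nat. norm (1 + exp (2 * of_real pi * \<i> * of_nat j / 5) * t * f z) powr p))
     = (\<Sum>j<5::nat. circle_int r (\<lambda>z. norm (1 + exp (2 * of_real pi * \<i> * of_nat j / 5) * t * f z) powr p))"
    by (intro circle_int_sum continuous_on_norm_powr continuous_intros assms) auto
  finally show ?thesis by simp
qed

lemma continuous_on_binomial_mean:
  assumes "0 < p" "continuous_on S f"
  shows "continuous_on S (\<lambda>z. binomial_mean p (f z))"
  unfolding binomial_mean_def
  by (intro continuous_on_norm_powr continuous_intros assms) auto

text \<open>Integrate the pointwise expansion at \<open>w = t * f z\<close>, admissible as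
  \<open>t * M \<le> 1/2\<close>; its error is at most \<open>C * (t * M) ^ 5\<close> on the whole
  circle.\<close>

lemma circle_int_expansion:
  fixes f :: "complex \<Rightarrow> complex"
  assumes p: "0 < p" and r: "0 \<le> r" and f: "continuous_on (sphere 0 r) f"
    and M: "\<And>z. z \<in> sphere 0 r \<Longrightarrow> norm (f z) \<le> M"
    and e: "\<And>w. norm w \<le> 1/2 \<Longrightarrow>
       \<bar>binomial_mean p w - (1 + a * norm w ^ 2 + b * norm w ^ 4)\<bar> \<le> C * norm w ^ 5"
    and C: "C \<ge> 0" and t: "0 \<le> t" "t * M \<le> 1/2"
  shows "\<bar>circle_int r (\<lambda>z. binomial_mean p (of_real t * f z)) -
    (2 * pi + a * t ^ 2 * circle_int r (\<lambda>z. norm (f z) ^ 2) + b * t ^ 4 * circle_int r (\<lambda>z. norm (f z) ^ 4))\<bar>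
    \<le> 2 * pi * C * M ^ 5 * t ^ 5"
proof -
  define P where "P z = 1 + (a * t ^ 2 * norm (f z) ^ 2 + b * t ^ 4 * norm (f z) ^ 4)" for z
  have cP: "continuous_on (sphere 0 r) P"
    unfolding P_def by (intro continuous_intros f)
  have cB: "continuous_on (sphere 0 r) (\<lambda>z. binomial_mean p (of_real t * f z))"
    by (intro continuous_on_binomial_mean continuous_intros p f)
  have "circle_int r P = circle_int r (\<lambda>z. 1 :: real) +
      (circle_int r (\<lambda>z. a * t ^ 2 * norm (f z) ^ 2) + circle_int r (\<lambda>z. b * t ^ 4 * norm (f z) ^ 4))"
    unfolding P_def
    by (simp add: circle_int_add[OF r] continuous_intros f del: circle_int_const)
  then have P: "circle_int r P = 2 * pi + a * t ^ 2 * circle_int r (\<lambda>z. norm (f z) ^ 2)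
      + b * t ^ 4 * circle_int r (\<lambda>z. norm (f z) ^ 4)"
    by (simp add: circle_int_cmult del: circle_int_const) simp
  have bound: "\<bar>binomial_mean p (of_real t * f z) - P z\<bar> \<le> C * M ^ 5 * t ^ 5" if z: "z \<in> sphere 0 r" for z
  proof -
    have n: "norm (of_real t * f z) = t * norm (f z)" using t by (simp add: norm_mult)
    have le: "t * norm (f z) \<le> t * M" using M[OF z] t by (simp add: mult_left_mono)
    then have "\<bar>binomial_mean p (of_real t * f z) - P z\<bar> \<le> C * (t * norm (f z)) ^ 5"
      using e[of "of_real t * f z"] t unfolding n P_def
      by (simp add: power_mult_distrib algebra_simps)
    also have "\<dots> \<le> C * (t * M) ^ 5"
      by (intro mult_left_mono power_mono le) (use t C in auto)
    finally show ?thesis by (simp add: power_mult_distrib mult_ac)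
  qed
  have "circle_int r (\<lambda>z. binomial_mean p (of_real t * f z)) - circle_int r P \<le> 2 * pi * (C * M ^ 5 * t ^ 5)"
    using circle_int_mono[of r "\<lambda>z. binomial_mean p (of_real t * f z) - P z" "\<lambda>_. C * M ^ 5 * t ^ 5"]
      bound r circle_int_diff[OF r cB cP]
    by (force intro!: continuous_intros cB cP simp: abs_le_iff)
  moreover have "circle_int r P - circle_int r (\<lambda>z. binomial_mean p (of_real t * f z)) \<le> 2 * pi * (C * M ^ 5 * t ^ 5)"
    using circle_int_mono[of r "\<lambda>z. P z - binomial_mean p (of_real t * f z)" "\<lambda>_. C * M ^ 5 * t ^ 5"]
      bound r circle_int_diff[OF r cP cB]
    by (force intro!: continuous_intros cB cP simp: abs_le_iff)
  ultimately show ?thesis unfolding P by (simp add: abs_le_iff mult_ac)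
qed

lemma eq_0_if_linear_bound:
  fixes x K d :: real
  assumes "\<And>t. 0 < t \<Longrightarrow> t < d \<Longrightarrow> \<bar>x\<bar> \<le> K * t" "0 < d"
  shows "x = 0"
proof (rule ccontr)
  assume "x \<noteq> 0"
  \<comment> \<open>Below \<open>d\<close>, and small enough that \<open>K * t\<close> is at most
    half of \<open>\<bar>x\<bar>\<close>.\<close>
  define t where "t = min (d / 2) (\<bar>x\<bar> / (2 * (\<bar>K\<bar> + 1)))"
  have t: "0 < t" "t < d" using assms(2) \<open>x \<noteq> 0\<close> by (auto simp: t_def min_less_iff_disj)
  have "(\<bar>K\<bar> + 1) * t \<le> (\<bar>K\<bar> + 1) * (\<bar>x\<bar> / (2 * (\<bar>K\<bar> + 1)))"
    by (intro mult_left_mono) (auto simp: t_def)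
  also have "\<dots> = \<bar>x\<bar> / 2" by (simp add: field_simps)
  finally have "(\<bar>K\<bar> + 1) * t < \<bar>x\<bar>" using \<open>x \<noteq> 0\<close> by simp
  moreover have "K * t \<le> (\<bar>K\<bar> + 1) * t" using t by (intro mult_right_mono) auto
  ultimately show False using assms(1)[OF t] by linarith
qed

text \<open>Divide by \<open>t ^ 2\<close> and let \<open>t\<close> tend to 0 to get
  \<open>x = 0\<close>; then divide by \<open>t ^ 4\<close>.\<close>

lemma coefficients_eq_0:
  fixes x y K d :: real
  assumes le: "\<And>t. 0 < t \<Longrightarrow> t < d \<Longrightarrow> \<bar>t ^ 2 * x + t ^ 4 * y\<bar> \<le> K * t ^ 5" and d: "0 < d"
  shows "x = 0" "y = 0"
proof -
  show x: "x = 0"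
  proof (rule eq_0_if_linear_bound)
    fix t :: real assume t: "0 < t" "t < min d 1"
    have "t ^ 2 * x + t ^ 4 * y = t ^ 2 * (x + t ^ 2 * y)"
      by (simp add: algebra_simps eval_nat_numeral)
    then have "\<bar>t ^ 2 * x + t ^ 4 * y\<bar> = t ^ 2 * \<bar>x + t ^ 2 * y\<bar>"
      by (simp add: abs_mult)
    then have "t ^ 2 * \<bar>x + t ^ 2 * y\<bar> \<le> t ^ 2 * (K * t ^ 3)"
      using le[of t] t by (simp add: eval_nat_numeral mult_ac)
    then have 1: "\<bar>x + t ^ 2 * y\<bar> \<le> K * t ^ 3" using t by simp
    have "t ^ 3 \<le> t ^ 1" "t ^ 2 \<le> t ^ 1" using t by (intro power_decreasing; simp)+
    then have "K * t ^ 3 \<le> \<bar>K\<bar> * t" "t ^ 2 * \<bar>y\<bar> \<le> \<bar>y\<bar> * t"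
      using t by (auto intro!: mult_mono simp: mult.commute[of "\<bar>y\<bar>"])
    moreover have "\<bar>t ^ 2 * y\<bar> = t ^ 2 * \<bar>y\<bar>" using t by (simp add: abs_mult)
    ultimately show "\<bar>x\<bar> \<le> (\<bar>K\<bar> + \<bar>y\<bar>) * t"
      using 1 unfolding distrib_right by linarith
  qed (use d in simp)
  show "y = 0"
  proof (rule eq_0_if_linear_bound)
    fix t :: real assume t: "0 < t" "t < d"
    have "t ^ 4 * \<bar>y\<bar> \<le> t ^ 4 * (K * t)"
      using le[OF t] t by (simp add: x abs_mult eval_nat_numeral mult_ac)
    then show "\<bar>y\<bar> \<le> K * t" using t by simp
  qed fact
qed

text \<open>Averaging \<open>eq\<close> over \<open>c = t * \<zeta>\<close> equates two expansions
  with the same \<open>a\<close> and \<open>b\<close>; since these are nonzero, comparing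
  coefficients gives the moments.\<close>

lemma circle_moments_eq:
  fixes u f :: "complex \<Rightarrow> complex"
  assumes p: "0 < p" "p \<noteq> 2" and r: "0 \<le> r"
    and u: "continuous_on (sphere 0 r) u" and f: "continuous_on (sphere 0 r) f"
    and eq: "\<And>c. circle_int r (\<lambda>z. norm (1 + c * u z) powr p) = circle_int r (\<lambda>z. norm (1 + c * f z) powr p)"
  shows "circle_int r (\<lambda>z. norm (u z) ^ 2) = circle_int r (\<lambda>z. norm (f z) ^ 2)"
    and "circle_int r (\<lambda>z. norm (u z) ^ 4) = circle_int r (\<lambda>z. norm (f z) ^ 4)"
proof -
  obtain a b C where ab: "a > 0" "b > 0" and C: "C \<ge> 0"
    and e: "\<And>w. norm w \<le> 1/2 \<Longrightarrow>
       \<bar>binomial_mean p w - (1 + a * norm w ^ 2 + b * norm w ^ 4)\<bar> \<le> C * norm w ^ 5"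
    using binomial_mean_expansion[OF p] by blast
  have "bounded (u ` sphere 0 r \<union> f ` sphere 0 r)"
    using u f by (simp add: compact_imp_bounded compact_continuous_image)
  then obtain M where M: "M > 0" "\<And>z. z \<in> sphere 0 r \<Longrightarrow> norm (u z) \<le> M" "\<And>z. z \<in> sphere 0 r \<Longrightarrow> norm (f z) \<le> M"
    unfolding bounded_pos by blast
  define U2 where "U2 = circle_int r (\<lambda>z. norm (u z) ^ 2)"
  define F2 where "F2 = circle_int r (\<lambda>z. norm (f z) ^ 2)"
  define U4 where "U4 = circle_int r (\<lambda>z. norm (u z) ^ 4)"
  define F4 where "F4 = circle_int r (\<lambda>z. norm (f z) ^ 4)"
  \<comment> \<open>The constant is twice the error \<open>2 * pi * C * M ^ 5\<close> of a single
    expansion.\<close>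
  have "\<bar>t ^ 2 * (a * (U2 - F2)) + t ^ 4 * (b * (U4 - F4))\<bar> \<le> (4 * pi * C * M ^ 5) * t ^ 5"
    if t: "0 < t" "t < 1 / (2 * M)" for t
  proof -
    have tM: "0 \<le> t" "t * M \<le> 1/2" using t M(1) by (auto simp: field_simps)
    have "circle_int r (\<lambda>z. binomial_mean p (of_real t * u z)) = circle_int r (\<lambda>z. binomial_mean p (of_real t * f z))"
      unfolding circle_int_binomial_mean[OF p(1) r u] circle_int_binomial_mean[OF p(1) r f] eq ..
    then show ?thesis
      using circle_int_expansion[OF p(1) r u M(2) e C tM, folded U2_def U4_def]
        circle_int_expansion[OF p(1) r f M(3) e C tM, folded F2_def F4_def]
      by (simp add: algebra_simps abs_le_iff)
  qed
  from coefficients_eq_0[OF this] M(1) ab show "U2 = F2" "U4 = F4" by simp_all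
qed

text \<open>
  Equality in the mean value inequality forces \<open>F\<close> to be real on the circle; then
  \<open>(F - 1)\<^sup>2\<close> is nonnegative there with mean \<open>(F 0 - 1)\<^sup>2 = 0\<close>.
\<close>

lemma powr_mean_eq_const:
  fixes F :: "complex \<Rightarrow> complex"
  assumes p: "1 \<le> p" and r: "0 < r" "r < 1" and F: "F holomorphic_on ball 0 1" "F 0 = 1"
    and m: "circle_int r (\<lambda>z. norm (F z) powr p) \<le> 2 * pi" and z: "z \<in> ball 0 1"
  shows "F z = 1"
proof -
  have r0: "0 \<le> r" using r by simp
  have hc: "F holomorphic_on cball 0 r" using F(1) by (rule holomorphic_on_subset) (use r in auto)
  then have c: "continuous_on (sphere 0 r) F"
    by (meson holomorphic_on_imp_continuous_on holomorphic_on_subset sphere_cball)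
  have cp: "continuous_on (sphere 0 r) (\<lambda>z. norm (F z) powr p)"
    by (intro continuous_on_norm_powr c) (use p in simp)
  have "circle_int r (\<lambda>z. Re (F z)) = 2 * pi"
    using circle_int_mean_value[OF hc r(1)] by (simp add: circle_int_Re[OF r0 c] F(2))
  then have i1: "circle_int r (\<lambda>z. 1 + p * (Re (F z) - 1)) = 2 * pi"
    by (simp add: circle_int_add[OF r0] circle_int_diff[OF r0] circle_int_cmult continuous_intros c)
  \<comment> \<open>Two successive lower bounds for \<open>norm w powr p\<close>. At
    \<open>w = F z\<close> the lowest one integrates to \<open>2 * pi\<close>, so the hypothesis
    \<open>m\<close> forces equality throughout on the circle.\<close>
  have le: "1 + p * (Re w - 1) \<le> 1 + p * (norm w - 1)" "1 + p * (norm w - 1) \<le> norm w powr p" for w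
    using p complex_Re_le_cmod[of w] by (auto intro!: mult_left_mono powr_Bernoulli)
  have real: "Im (F z) = 0" if z: "z \<in> sphere 0 r" for z
  proof -
    have "norm (F z) powr p - (1 + p * (Re (F z) - 1)) = 0"
    proof (rule circle_int_eq_0D[OF r0 _ _ _ z])
      show "circle_int r (\<lambda>z. norm (F z) powr p - (1 + p * (Re (F z) - 1))) \<le> 0"
        using m i1 by (subst circle_int_diff[OF r0 cp]) (auto intro!: continuous_intros c)
    next
      show "0 \<le> norm (F z) powr p - (1 + p * (Re (F z) - 1))" for z
        using le[of "F z"] by linarith
    qed (intro continuous_intros c cp)
    then have "p * (norm (F z) - 1) \<le> p * (Re (F z) - 1)"
      using le(2)[of "F z"] by linarith
    then have "norm (F z) \<le> Re (F z)" using p by simp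
    then have "norm (F z) = Re (F z)" using complex_Re_le_cmod[of "F z"] by linarith
    then have "(Re (F z))\<^sup>2 + (Im (F z))\<^sup>2 = (Re (F z))\<^sup>2"
      by (metis cmod_power2)
    then show ?thesis by simp
  qed
  have h2: "(\<lambda>z. (F z - 1) ^ 2) holomorphic_on cball 0 r"
    by (intro holomorphic_intros hc)
  have c2: "continuous_on (sphere 0 r) (\<lambda>z. (F z - 1) ^ 2)"
    by (intro continuous_intros c)
  have "circle_int r (\<lambda>z. Re ((F z - 1) ^ 2)) = 0"
    using circle_int_mean_value[OF h2 r(1)] by (simp only: circle_int_Re[OF r0 c2]) (simp add: F(2))
  moreover have sq: "Re ((F z - 1) ^ 2) = (Re (F z) - 1) ^ 2" if "z \<in> sphere 0 r" for z
    using real[OF that] by (simp add: power2_eq_square)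
  ultimately have "Re ((F z - 1) ^ 2) = 0" if "z \<in> sphere 0 r" for z
    by (intro circle_int_eq_0D[OF r0 _ _ _ that]) (auto intro!: continuous_intros c simp: sq)
  then have "(Re (F z) - 1) ^ 2 = 0" if "z \<in> sphere 0 r" for z
    using that sq by metis
  then have "F z = 1" if "z \<in> sphere 0 r" for z
    using that real[OF that] by (simp add: complex_eq_iff)
  then show ?thesis
    using holomorphic_eq_0_of_circle[of "\<lambda>z. F z - 1" r z] r z
    by (simp add: holomorphic_on_diff F(1))
qed

section \<open>Unital isometries\<close>

text \<open>Members of \<open>Hol\<close> vanish off the disc, so constants and the identity have to
  be cut off before \<open>S\<close> can be applied to them.\<close>

definition zext :: "(complex \<Rightarrow> complex) \<Rightarrow> complex \<Rightarrow> complex"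
  where "zext f z = (if z \<in> \<bbbD> then f z else 0)"

lemma zext_in [simp]: "z \<in> \<bbbD> \<Longrightarrow> zext f z = f z"
  by (simp add: zext_def)

lemma zext_Hol [intro]: "f holomorphic_on \<bbbD> \<Longrightarrow> zext f \<in> Hol"
  unfolding Hol_def by (auto simp: zext_def intro: holomorphic_transform)

lemma HolD: "f \<in> Hol \<Longrightarrow> f holomorphic_on \<bbbD>" "f \<in> Hol \<Longrightarrow> z \<notin> \<bbbD> \<Longrightarrow> f z = 0"
  by (auto simp: Hol_def)

lemma Hol_eqI:
  assumes "f \<in> Hol" "g \<in> Hol" "\<And>z. z \<in> \<bbbD> \<Longrightarrow> f z = g z"
  shows "f = g"
  using assms by (metis HolD(2) ext)

lemma Hol_add [intro]: "f \<in> Hol \<Longrightarrow> g \<in> Hol \<Longrightarrow> (\<lambda>z. f z + g z) \<in> Hol"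
  and Hol_diff [intro]: "f \<in> Hol \<Longrightarrow> g \<in> Hol \<Longrightarrow> (\<lambda>z. f z - g z) \<in> Hol"
  and Hol_mult [intro]: "f \<in> Hol \<Longrightarrow> g \<in> Hol \<Longrightarrow> (\<lambda>z. f z * g z) \<in> Hol"
  and Hol_cmult [intro]: "f \<in> Hol \<Longrightarrow> (\<lambda>z. c * f z) \<in> Hol"
  and Hol_square [intro]: "f \<in> Hol \<Longrightarrow> (\<lambda>z. f z ^ 2) \<in> Hol"
  by (auto simp: Hol_def intro!: holomorphic_intros)

lemma Hol_continuous_on_sphere:
  assumes "f \<in> Hol" "r < 1"
  shows "continuous_on (sphere 0 r) f"
  using assms(2) by (intro holomorphic_on_imp_continuous_on holomorphic_on_subset[OF HolD(1)[OF assms(1)]]) auto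

text \<open>
  The point of the shape of this definition is that the mean of \<open>cubic \<circ> f\<close> is a combination
  of second and fourth moments of \<open>1 + f\<close> and \<open>1 - f\<close>.
\<close>

definition cubic :: "complex \<Rightarrow> real"
  where "cubic w = (norm (1 + w) ^ 4 - norm (1 - w) ^ 4) / 8 - (norm (1 + w) ^ 2 - norm (1 - w) ^ 2) / 4"

text \<open>With \<open>s = 1 + norm w ^ 2\<close> and \<open>x = Re w\<close>, the difference of
  fourth powers is \<open>8 * s * x\<close> and that of squares is \<open>4 * x\<close>.\<close>

lemma cubic_eq: "cubic w = norm w ^ 2 * Re w"
proof -
  have *: "norm z ^ 4 = ((Re z)\<^sup>2 + (Im z)\<^sup>2)\<^sup>2" for z
    by (simp flip: cmod_power2 power_mult)
  show ?thesis
    unfolding cubic_def * cmod_power2 by (simp add: field_simps power2_eq_square)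
qed

text \<open>The cross term is \<open>2 * Re (u ^ 2 * cnj v)\<close>. The part of
  \<open>cubic (u + v)\<close> linear in \<open>v\<close> is
  \<open>2 * norm u ^ 2 * Re v + Re (u ^ 2 * cnj v)\<close>; replacing \<open>u\<close> by
  \<open>\<i> * u\<close> changes the sign of the second summand only.\<close>

lemma norm_square_diff_polarised:
  "norm (u ^ 2 - v) ^ 2 = norm u ^ 4 + norm v ^ 2 -
     (cubic (u + v) - cubic (u - v) - cubic (\<i> * u + v) + cubic (\<i> * u - v)) / 2"
proof -
  have *: "norm z ^ 4 = ((Re z)\<^sup>2 + (Im z)\<^sup>2)\<^sup>2" for z
    by (simp flip: cmod_power2 power_mult)
  show ?thesis
    unfolding cubic_eq * cmod_power2 by (simp add: field_simps power2_eq_square)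
qed

lemma continuous_on_cubic [continuous_intros]:
  "continuous_on A f \<Longrightarrow> continuous_on A (\<lambda>x. cubic (f x))"
  unfolding cubic_def by (intro continuous_intros) auto

text \<open>A model of \<open>T\<close> divided by \<open>\<alpha>\<close>. \<open>R\<close> stands
  for the positive radii \<open>1 - 1 / n\<close>, which approach 1; the radius 0 is recorded
  separately as \<open>isometry_0\<close>.\<close>

locale unital_isometry =
  fixes p :: real and R :: "real set" and S :: "(complex \<Rightarrow> complex) \<Rightarrow> complex \<Rightarrow> complex"
  assumes p: "0 < p" "p \<noteq> 2"
    and R: "R \<subseteq> {0<..<1}" "\<And>x. x < 1 \<Longrightarrow> \<exists>r\<in>R. x < r"
    and S_Hol: "f \<in> Hol \<Longrightarrow> S f \<in> Hol"
    and lin: "linear_on_Hol S"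
    and isometry: "f \<in> Hol \<Longrightarrow> r \<in> R \<Longrightarrow>
      circle_int r (\<lambda>z. norm (S f z) powr p) = circle_int r (\<lambda>z. norm (f z) powr p)"
    and isometry_0: "f \<in> Hol \<Longrightarrow> norm (S f 0) = norm (f 0)"
    and unital: "S (zext (\<lambda>_. 1)) = zext (\<lambda>_. 1)"
begin

section \<open>Invariant means and multiplicativity\<close>

lemma S_add: "f \<in> Hol \<Longrightarrow> g \<in> Hol \<Longrightarrow> S (\<lambda>z. f z + g z) = (\<lambda>z. S f z + S g z)"
  and S_cmult: "f \<in> Hol \<Longrightarrow> S (\<lambda>z. c * f z) = (\<lambda>z. c * S f z)"
  using lin unfolding linear_on_Hol_def by auto

lemma S_diff:
  assumes "f \<in> Hol" "g \<in> Hol"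
  shows "S (\<lambda>z. f z - g z) = (\<lambda>z. S f z - S g z)"
  using S_add[OF assms(1) Hol_cmult[OF assms(2), of "-1"]] by (simp add: S_cmult[OF assms(2), of "-1", simplified])

lemma one_Hol: "zext (\<lambda>_. 1) \<in> Hol"
  by (intro zext_Hol holomorphic_intros)

context
  fixes r assumes r: "r \<in> R"
begin

lemma r_bounds: "0 < r" "0 \<le> r" "r < 1"
  using r R by force+

lemma cont: "f \<in> Hol \<Longrightarrow> continuous_on (sphere 0 r) f" "f \<in> Hol \<Longrightarrow> continuous_on (sphere 0 r) (S f)"
  by (intro Hol_continuous_on_sphere S_Hol r_bounds; assumption)+

lemma zext_sphere: "z \<in> sphere 0 r \<Longrightarrow> zext f z = f z"
  using r_bounds by simp

lemma circle_int_one: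
  "circle_int r (\<lambda>z. \<Phi> (zext (\<lambda>_. 1) z + f z)) = circle_int r (\<lambda>z. \<Phi> (1 + f z))"
  "circle_int r (\<lambda>z. \<Phi> (zext (\<lambda>_. 1) z - f z)) = circle_int r (\<lambda>z. \<Phi> (1 - f z))"
  by (intro circle_int_cong r_bounds; simp only: zext_sphere)+

text \<open>Apply the isometry to \<open>1 + c * f\<close>, whose image is
  \<open>1 + c * S f\<close> because \<open>S\<close> is linear and unital.\<close>

lemma moments:
  assumes f: "f \<in> Hol"
  shows "circle_int r (\<lambda>z. norm (S f z) ^ 2) = circle_int r (\<lambda>z. norm (f z) ^ 2)"
    and "circle_int r (\<lambda>z. norm (S f z) ^ 4) = circle_int r (\<lambda>z. norm (f z) ^ 4)"
proof -
  have "circle_int r (\<lambda>z. norm (1 + c * S f z) powr p) = circle_int r (\<lambda>z. norm (1 + c * f z) powr p)" for c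
  proof -
    let ?h = "\<lambda>z. zext (\<lambda>_. 1) z + c * f z"
    have "S ?h = (\<lambda>z. zext (\<lambda>_. 1) z + c * S f z)"
      by (simp add: S_add S_cmult f one_Hol Hol_cmult unital)
    then have "circle_int r (\<lambda>z. norm (zext (\<lambda>_. 1) z + c * S f z) powr p) = circle_int r (\<lambda>z. norm (?h z) powr p)"
      using isometry[of ?h r] f one_Hol r by (metis Hol_add Hol_cmult)
    then show ?thesis
      by (simp only: circle_int_one[where \<Phi> = "\<lambda>w. norm w powr p"])
  qed
  then show "circle_int r (\<lambda>z. norm (S f z) ^ 2) = circle_int r (\<lambda>z. norm (f z) ^ 2)"
    "circle_int r (\<lambda>z. norm (S f z) ^ 4) = circle_int r (\<lambda>z. norm (f z) ^ 4)"
    by (intro circle_moments_eq[OF p r_bounds(2)] cont f; simp)+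
qed

lemma circle_int_cubic:
  assumes f: "continuous_on (sphere 0 r) f"
  shows "circle_int r (\<lambda>z. cubic (f z)) =
     (circle_int r (\<lambda>z. norm (1 + f z) ^ 4) - circle_int r (\<lambda>z. norm (1 - f z) ^ 4)) / 8
     - (circle_int r (\<lambda>z. norm (1 + f z) ^ 2) - circle_int r (\<lambda>z. norm (1 - f z) ^ 2)) / 4"
proof -
  have "cubic w = (1/8) * (norm (1 + w) ^ 4 - norm (1 - w) ^ 4) - (1/4) * (norm (1 + w) ^ 2 - norm (1 - w) ^ 2)" for w
    by (simp add: cubic_def)
  then show ?thesis
    by (simp add: circle_int_diff circle_int_cmult r_bounds continuous_intros f del: times_divide_eq_left)
qed

text \<open>The mean involves only moments of \<open>1 + f\<close> and \<open>1 - f\<close>, whose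
  images are \<open>1 + S f\<close> and \<open>1 - S f\<close>.\<close>

lemma cubic_invariant:
  assumes f: "f \<in> Hol"
  shows "circle_int r (\<lambda>z. cubic (S f z)) = circle_int r (\<lambda>z. cubic (f z))"
proof -
  have S: "S (\<lambda>z. zext (\<lambda>_. 1) z + f z) = (\<lambda>z. zext (\<lambda>_. 1) z + S f z)"
    "S (\<lambda>z. zext (\<lambda>_. 1) z - f z) = (\<lambda>z. zext (\<lambda>_. 1) z - S f z)"
    by (simp_all add: S_add S_diff f one_Hol unital)
  have "circle_int r (\<lambda>z. norm (1 + S f z) ^ k) = circle_int r (\<lambda>z. norm (1 + f z) ^ k)"
    "circle_int r (\<lambda>z. norm (1 - S f z) ^ k) = circle_int r (\<lambda>z. norm (1 - f z) ^ k)" if "k = 2 \<or> k = 4" for k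
    using that moments[OF Hol_add[OF one_Hol f]] moments[OF Hol_diff[OF one_Hol f]] unfolding S
    by (auto simp only: circle_int_one[where \<Phi> = "\<lambda>w. norm w ^ 2"] circle_int_one[where \<Phi> = "\<lambda>w. norm w ^ 4"])
  then show ?thesis
    by (simp add: circle_int_cubic cont f)
qed

lemma circle_int_norm_square_diff:
  assumes u: "continuous_on (sphere 0 r) u" and v: "continuous_on (sphere 0 r) v"
  shows "circle_int r (\<lambda>z. norm (u z ^ 2 - v z) ^ 2) =
     circle_int r (\<lambda>z. norm (u z) ^ 4) + circle_int r (\<lambda>z. norm (v z) ^ 2) -
     (circle_int r (\<lambda>z. cubic (u z + v z)) - circle_int r (\<lambda>z. cubic (u z - v z))
      - circle_int r (\<lambda>z. cubic (\<i> * u z + v z)) + circle_int r (\<lambda>z. cubic (\<i> * u z - v z))) / 2"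
proof -
  have "norm (x ^ 2 - y) ^ 2 = norm x ^ 4 + norm y ^ 2 -
     (1/2) * (cubic (x + y) - cubic (x - y) - cubic (\<i> * x + y) + cubic (\<i> * x - y))" for x y
    by (simp add: norm_square_diff_polarised)
  then show ?thesis
    by (simp add: circle_int_diff circle_int_add circle_int_cmult r_bounds continuous_intros u v
        del: times_divide_eq_left)
qed

text \<open>After polarisation only moments of \<open>f\<close> and \<open>g\<close> and means of
  \<open>cubic\<close> at linear combinations remain, all invariant under \<open>S\<close>.\<close>

lemma square_diff_invariant:
  assumes f: "f \<in> Hol" and g: "g \<in> Hol"
  shows "circle_int r (\<lambda>z. norm (S f z ^ 2 - S g z) ^ 2) = circle_int r (\<lambda>z. norm (f z ^ 2 - g z) ^ 2)"
  using cubic_invariant[OF Hol_add[OF f g]] cubic_invariant[OF Hol_diff[OF f g]]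
    cubic_invariant[OF Hol_add[OF Hol_cmult[OF f, of \<i>] g]]
    cubic_invariant[OF Hol_diff[OF Hol_cmult[OF f, of \<i>] g]]
  by (simp add: circle_int_norm_square_diff cont f g moments S_add S_diff S_cmult Hol_cmult)

text \<open>Take \<open>g\<close> to be the square of \<open>f\<close> in
  \<open>square_diff_invariant\<close>: the mean on the right is then 0.\<close>

lemma S_square_circle:
  assumes f: "f \<in> Hol" and z: "z \<in> sphere 0 r"
  shows "S (\<lambda>z. f z ^ 2) z = S f z ^ 2"
proof -
  have "norm (S f z ^ 2 - S (\<lambda>z. f z ^ 2) z) ^ 2 = 0"
  proof (rule circle_int_eq_0D[OF r_bounds(2) _ _ _ z])
    show "circle_int r (\<lambda>z. norm (S f z ^ 2 - S (\<lambda>z. f z ^ 2) z) ^ 2) \<le> 0"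
      using square_diff_invariant[OF f Hol_square[OF f]] by simp
  qed (intro continuous_intros cont f Hol_square zero_le_power norm_ge_zero)+
  then show ?thesis by simp
qed

text \<open>Let \<open>G\<close> be the image of the identity. Its moments make the mean of
  \<open>(norm (G z) ^ 2 - r ^ 2) ^ 2\<close> equal to
  \<open>r ^ 4 - 2 * r ^ 4 + r ^ 4 = 0\<close>.\<close>

lemma norm_S_id_circle:
  assumes z: "z \<in> sphere 0 r"
  shows "norm (S (zext (\<lambda>z. z)) z) = r"
proof -
  let ?I = "zext (\<lambda>z. z)"
  have I: "?I \<in> Hol" by (intro zext_Hol holomorphic_intros)
  have m: "circle_int r (\<lambda>z. norm (S ?I z) ^ k) = 2 * pi * r ^ k" if k: "k = 2 \<or> k = 4" for k
  proof -
    have "circle_int r (\<lambda>z. norm (?I z) ^ k) = circle_int r (\<lambda>z. r ^ k)"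
      by (intro circle_int_cong r_bounds) (simp add: zext_sphere)
    then show ?thesis using moments[OF I] k by auto
  qed
  have "(norm (S ?I z) ^ 2 - r ^ 2) ^ 2 = 0"
  proof (rule circle_int_eq_0D[OF r_bounds(2) _ _ _ z])
    have "circle_int r (\<lambda>z. (norm (S ?I z) ^ 2 - r ^ 2) ^ 2) =
        circle_int r (\<lambda>z. norm (S ?I z) ^ 4 - (2 * r ^ 2) * norm (S ?I z) ^ 2 + r ^ 4)"
      by (simp add: power2_diff algebra_simps flip: power_mult)
    also have "\<dots> = 2 * pi * r ^ 4 - (2 * r ^ 2) * (2 * pi * r ^ 2) + 2 * pi * r ^ 4"
      by (simp add: circle_int_add circle_int_diff circle_int_cmult m r_bounds continuous_intros cont I
        del: mult.assoc)
    also have "\<dots> = 0" by (simp add: eval_nat_numeral)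
    finally show "circle_int r (\<lambda>z. (norm (S ?I z) ^ 2 - r ^ 2) ^ 2) \<le> 0" by simp
  qed (intro continuous_intros cont I zero_le_power2)+
  then show ?thesis using r_bounds by (simp add: power2_eq_iff_nonneg)
qed

end

lemma S_square:
  assumes f: "f \<in> Hol"
  shows "S (\<lambda>z. f z ^ 2) = (\<lambda>z. S f z ^ 2)"
proof (rule Hol_eqI)
  obtain r where r: "r \<in> R" using R(2)[of 0] by auto
  fix z assume z: "z \<in> \<bbbD>"
  have "S (\<lambda>z. f z ^ 2) z - S f z ^ 2 = 0"
    by (rule holomorphic_eq_0_of_circle[OF _ r_bounds(1)[OF r] r_bounds(3)[OF r] _ z])
       (intro holomorphic_intros HolD(1) S_Hol Hol_square f, simp add: S_square_circle[OF r f])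
  then show "S (\<lambda>z. f z ^ 2) z = S f z ^ 2" by simp
qed (intro S_Hol Hol_square f)+

text \<open>Polarisation: compare the cross terms in the square of \<open>f + g\<close>.\<close>

lemma S_mult:
  assumes f: "f \<in> Hol" and g: "g \<in> Hol"
  shows "S (\<lambda>z. f z * g z) = (\<lambda>z. S f z * S g z)"
proof -
  have "S (\<lambda>z. f z ^ 2 + (g z ^ 2 + 2 * (f z * g z))) = S (\<lambda>z. (f z + g z) ^ 2)"
    by (simp add: power2_sum mult.assoc add.assoc)
  also have "\<dots> = (\<lambda>z. (S f z + S g z) ^ 2)"
    by (simp add: S_square S_add Hol_add f g)
  also have "S (\<lambda>z. f z ^ 2 + (g z ^ 2 + 2 * (f z * g z))) =
      (\<lambda>z. S f z ^ 2 + (S g z ^ 2 + 2 * S (\<lambda>z. f z * g z) z))"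
    by (simp add: S_add S_cmult S_square Hol_add Hol_cmult Hol_square Hol_mult f g)
  finally have "S f z ^ 2 + (S g z ^ 2 + 2 * S (\<lambda>z. f z * g z) z) = (S f z + S g z) ^ 2" for z
    by metis
  then show ?thesis by (simp add: power2_sum fun_eq_iff)
qed

section \<open>Composition with the image of the identity\<close>

lemma id_Hol: "zext (\<lambda>z. z) \<in> Hol"
  by (intro zext_Hol holomorphic_intros)

text \<open>Some radius in \<open>R\<close> exceeds \<open>norm z\<close>; the maximum modulus
  principle on that circle bounds the value by \<open>r < 1\<close>.\<close>

lemma S_id_in_disc:
  assumes z: "z \<in> \<bbbD>"
  shows "S (zext (\<lambda>z. z)) z \<in> \<bbbD>"
proof -
  obtain r where r: "r \<in> R" "norm z < r" using R(2)[of "norm z"] z by auto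
  note rb = r_bounds[OF r(1)]
  have hol: "S (zext (\<lambda>z. z)) holomorphic_on cball 0 r"
    using HolD(1)[OF S_Hol[OF id_Hol]] by (rule holomorphic_on_subset) (use rb in auto)
  have "norm (S (zext (\<lambda>z. z)) z) \<le> r"
  proof (rule maximum_modulus_frontier[of "S (zext (\<lambda>z. z))" "cball 0 r" r z])
    show "S (zext (\<lambda>z. z)) holomorphic_on interior (cball 0 r)"
      by (rule holomorphic_on_subset[OF hol]) auto
    show "continuous_on (closure (cball 0 r)) (S (zext (\<lambda>z. z)))"
      using hol by (simp add: holomorphic_on_imp_continuous_on)
    show "norm (S (zext (\<lambda>z. z)) w) \<le> r" if "w \<in> frontier (cball 0 r)" for w
      using norm_S_id_circle[OF r(1)] that rb by simp
  qed (use r in auto)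
  then show ?thesis using rb by simp
qed

text \<open>
  With \<open>G = S z\<close> and \<open>a = G z\<close>, apply the multiplicative map \<open>S\<close> to \<open>f - f a = (z - a) h\<close>
  and evaluate at \<open>z\<close>.
\<close>

lemma S_eq_comp:
  assumes f: "f \<in> Hol" and z: "z \<in> \<bbbD>"
  shows "S f z = f (S (zext (\<lambda>z. z)) z)"
proof -
  define a where "a = S (zext (\<lambda>z. z)) z"
  have a: "a \<in> \<bbbD>" unfolding a_def using z by (rule S_id_in_disc)
  \<comment> \<open>The difference quotient of \<open>f\<close> at \<open>a\<close>; the value
    \<open>deriv f a\<close> removes the singularity.\<close>
  define h where "h = zext (\<lambda>w. if w = a then deriv f a else (f w - f a) / (w - a))"
  have h: "h \<in> Hol"
    unfolding h_def by (intro zext_Hol pole_lemma_open HolD(1) f) simp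
  have "f = (\<lambda>w. f a * zext (\<lambda>_. 1) w + (zext (\<lambda>z. z) w - a * zext (\<lambda>_. 1) w) * h w)"
    by (rule Hol_eqI[OF f]) (intro Hol_add Hol_diff Hol_cmult Hol_mult one_Hol id_Hol h, simp add: h_def)
  then have "S f = S (\<lambda>w. f a * zext (\<lambda>_. 1) w + (zext (\<lambda>z. z) w - a * zext (\<lambda>_. 1) w) * h w)"
    by (rule arg_cong)
  also have "\<dots> = (\<lambda>w. f a * zext (\<lambda>_. 1) w + (S (zext (\<lambda>z. z)) w - a * zext (\<lambda>_. 1) w) * S h w)"
    by (simp add: S_add S_diff S_mult S_cmult Hol_diff Hol_cmult Hol_mult one_Hol id_Hol h unital)
  finally show ?thesis using z by (simp add: a_def)
qed

lemma rotation: "\<exists>\<beta>\<in>\<bbbT>. \<forall>f\<in>Hol. \<forall>z\<in>\<bbbD>. S f z = f (\<beta> * z)"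
proof -
  let ?G = "S (zext (\<lambda>z. z))"
  obtain r where r: "r \<in> R" using R(2)[of 0] by auto
  note rb = r_bounds[OF r]
  have "\<exists>\<beta>. (\<forall>z. norm z < 1 \<longrightarrow> ?G z = \<beta> * z) \<and> norm \<beta> = 1"
  proof (rule Schwarz_Lemma(3)[of _ 0])
    show "?G holomorphic_on \<bbbD>" by (intro HolD(1) S_Hol id_Hol)
    show "?G 0 = 0" using isometry_0[OF id_Hol] by simp
    show "norm (?G z) < 1" if "norm z < 1" for z using S_id_in_disc[of z] that by simp
    \<comment> \<open>The equality case of the Schwarz lemma occurs at the real point
      \<open>r\<close>.\<close>
    show "(\<exists>z. norm z < 1 \<and> z \<noteq> 0 \<and> norm (?G z) = norm z) \<or> norm (deriv ?G 0) = 1"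
      using norm_S_id_circle[OF r, of "of_real r"] rb by (intro disjI1 exI[of _ "of_real r"]) simp
  qed simp
  then obtain \<beta> where "norm \<beta> = 1" "\<And>z. z \<in> \<bbbD> \<Longrightarrow> ?G z = \<beta> * z" by auto
  then show ?thesis by (intro bexI[of _ \<beta>]) (simp_all add: S_eq_comp)
qed

end

section \<open>Reduction of the theorem to a unital isometry\<close>

lemma circle_int_eq_of_pn_norm_eq:
  assumes "1 \<le> p" "pn_norm p n u = pn_norm p n f"
  defines "r \<equiv> 1 - 1 / real n"
  shows "circle_int r (\<lambda>z. norm (u z) powr p) = circle_int r (\<lambda>z. norm (f z) powr p)"
proof -
  \<comment> \<open>Nonnegativity lets \<open>powr p\<close> undo \<open>powr (1 / p)\<close>. As
    \<open>f\<close> is arbitrary here, a nonintegrable integrand is covered by the default value 0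
    of the integral.\<close>
  have nonneg: "0 \<le> circle_int r (\<lambda>z. norm (f z) powr p)" for f
    unfolding circle_int_def by (cases "(\<lambda>\<theta>. norm (f (of_real r * exp (\<i> * of_real \<theta>))) powr p) integrable_on {0..2*pi}")
      (auto simp: integral_nonneg not_integrable_integral)
  have *: "pn_norm p n f = (1 / (2 * pi) * circle_int r (\<lambda>z. norm (f z) powr p)) powr (1 / p)" for f
    unfolding pn_norm_def circle_int_def r_def ..
  have "circle_int r (\<lambda>z. norm (f z) powr p) = 2 * pi * pn_norm p n f powr p" for f
    unfolding * powr_powr using assms(1) nonneg[of f] by simp
  then show ?thesis using assms(2) by simp
qed

theorem theorem3p3:
  fixes p :: real
    and T :: "(complex \<Rightarrow> complex) \<Rightarrow> (complex \<Rightarrow> complex)"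
  assumes "1 \<le> p" and "p \<noteq> 2"
    and "T \<in> Hol \<rightarrow> Hol"
    and "linear_on_Hol T"
    and "continuous_map Hol_topology Hol_topology T"
    and "\<And>f n. f \<in> Hol \<Longrightarrow> 1 \<le> n \<Longrightarrow> pn_norm p n (T f) = pn_norm p n f"
  shows "\<exists>\<alpha>\<in>\<bbbT>. \<exists>\<beta>\<in>\<bbbT>. \<forall>f\<in>Hol. \<forall>z\<in>\<bbbD>. T f z = \<alpha> * f (\<beta> * z)"
proof -
  \<comment> \<open>Starting at 2 keeps the radii positive; \<open>n = 1\<close> gives the radius 0
    and serves for \<open>iso0\<close>.\<close>
  define R where "R = (\<lambda>n. 1 - 1 / real n) ` {2..}"
  define one where "one = zext (\<lambda>_. 1)"
  define \<alpha> where "\<alpha> = T one 0"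
  have one: "one \<in> Hol" unfolding one_def by (intro zext_Hol holomorphic_intros)
  have iso: "circle_int r (\<lambda>z. norm (T f z) powr p) = circle_int r (\<lambda>z. norm (f z) powr p)"
    if f: "f \<in> Hol" and r: "r \<in> R" for f r
  proof -
    obtain n :: nat where n: "r = 1 - 1 / real n" "1 \<le> n"
      using r by (auto simp: R_def)
    show ?thesis
      unfolding n(1) by (rule circle_int_eq_of_pn_norm_eq[OF assms(1) assms(6)[OF f n(2)]])
  qed
  have iso0: "norm (T f 0) = norm (f 0)" if "f \<in> Hol" for f
  proof -
    have "norm (T f 0) powr p = norm (f 0) powr p"
      using circle_int_eq_of_pn_norm_eq[OF assms(1) assms(6)[OF that, of 1]] by (simp add: circle_int_def)
    then have "(norm (T f 0) powr p) powr (1 / p) = (norm (f 0) powr p) powr (1 / p)"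
      by (rule arg_cong)
    then show ?thesis using assms(1) by (simp add: powr_powr)
  qed
  have \<alpha>: "norm \<alpha> = 1" using iso0[OF one] by (simp add: \<alpha>_def one_def)
  have R01: "R \<subseteq> {0<..<1}" by (auto simp: R_def)
  have R_sup: "\<exists>r\<in>R. x < r" if "x < 1" for x
  proof -
    \<comment> \<open>This gives \<open>1 / n < 1 - x\<close>; the later shift by 2 puts the index
      into the range that defines \<open>R\<close>.\<close>
    obtain n where n: "1 / (1 - x) < real n" using reals_Archimedean2 by blast
    have "x < 1 - 1 / real (n + 2)"
      using n that by (simp add: field_simps)
    moreover have "1 - 1 / real (n + 2) \<in> R"
      unfolding R_def by (rule imageI) simp
    ultimately show "\<exists>r\<in>R. x < r" by blast
  qed
  have TH: "T f \<in> Hol" if "f \<in> Hol" for f using assms(3) that by blast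
  \<comment> \<open>On the circle of radius 1/2, from \<open>n = 2\<close>,
    \<open>T one / \<alpha>\<close> has the same mean as the constant 1, and its value at 0 is 1, so
    \<open>powr_mean_eq_const\<close> applies.\<close>
  have T_one: "T one z = \<alpha>" if z: "z \<in> \<bbbD>" for z
  proof -
    have half: "1/2 \<in> R" by (auto simp: R_def image_iff intro!: bexI[of _ 2])
    have "circle_int (1/2) (\<lambda>z. norm (T one z / \<alpha>) powr p) = circle_int (1/2) (\<lambda>z. norm (one z) powr p)"
      using iso[OF one half] \<alpha> by (simp add: norm_divide)
    also have "\<dots> = circle_int (1/2) (\<lambda>z. 1)"
      by (intro circle_int_cong) (auto simp: one_def)
    finally have mean: "circle_int (1/2) (\<lambda>z. norm (T one z / \<alpha>) powr p) = 2 * pi"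
      by simp
    have "T one z / \<alpha> = 1"
    proof (rule powr_mean_eq_const[OF assms(1), where r = "1/2" and F = "\<lambda>z. T one z / \<alpha>"])
      show "(\<lambda>z. T one z / \<alpha>) holomorphic_on \<bbbD>"
        using \<alpha> by (intro holomorphic_intros HolD(1) TH one) auto
      show "T one 0 / \<alpha> = 1" using \<alpha> by (auto simp flip: \<alpha>_def)
    qed (use z mean in simp_all)
    then show ?thesis using \<alpha> by (auto simp: field_simps)
  qed
  interpret unital_isometry p R "\<lambda>f z. T f z / \<alpha>"
  proof
    show "linear_on_Hol (\<lambda>f z. T f z / \<alpha>)"
      using assms(4) by (simp add: linear_on_Hol_def add_divide_distrib)
    show "(\<lambda>z. T f z / \<alpha>) \<in> Hol" if "f \<in> Hol" for f
      using Hol_cmult[OF TH[OF that], of "1/\<alpha>"] by simp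
    show "(\<lambda>z. T (zext (\<lambda>_. 1)) z / \<alpha>) = zext (\<lambda>_. 1)"
      using Hol_cmult[OF TH[OF one], of "1/\<alpha>"] \<alpha> T_one one
      by (intro Hol_eqI) (auto simp: one_def)
  qed (use assms(1,2) R01 R_sup \<alpha> iso iso0 in \<open>simp_all add: norm_divide\<close>)
  obtain \<beta> where \<beta>: "\<beta> \<in> \<bbbT>" "\<And>f z. f \<in> Hol \<Longrightarrow> z \<in> \<bbbD> \<Longrightarrow> T f z / \<alpha> = f (\<beta> * z)"
    using rotation by blast
  have "\<alpha> \<noteq> 0" using \<alpha> by auto
  then have "T f z = \<alpha> * f (\<beta> * z)" if "f \<in> Hol" "z \<in> \<bbbD>" for f z
    using \<beta>(2)[OF that] by (simp add: nonzero_divide_eq_eq mult.commute)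
  moreover have "\<alpha> \<in> \<bbbT>" using \<alpha> by simp
  ultimately show ?thesis using \<beta>(1) by blast
qed

end
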